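(* Let $G=(V,E)$ be a finite simple $C_4$-free graph. The algorithm $\mathrm{EnumIM}(G)$ described in the context outputs every induced matching of $G$, outputs only induced matchings of $G$, and outputs each induced matching exactly once.
   Context: Graphs are finite, undirected, without loops or parallel edges. A graph is $C_4$-free if it contains no cycle of length four as a subgraph. An induced matching of $G$ is a set $M\subseteq E$ of edges such that for any two distinct $e,e'\in M$, $e$ and $e'$ share no endpoint and no edge of $G$ joins an endpoint of $e$ to an endpoint of $e'$ (equivalently $\mathrm{dist}_G(e,e')\ge 2$, where the distance between edges is the minimum distance between their endpoints). For a graph $H$, a vertex $v$ and integers $k,\ell$, let $D_v(k,\ell)=\{\{x,y\}\in E(H): \mathrm{dist}_H(x,v)=k,\ \mathrm{dist}_H(y,v)=\ell\}$ and $D_v(k)=D_v(k,k)\cup D_v(k,k+1)$; for an edge $e$ incident to $v$, $\mathrm{Sect}_e(2)=\{f\in D_v(2): \mathrm{dist}_H(v,f)=2,\ \mathrm{dist}_H(e,f)=1\}$. The algorithm $\mathrm{EnumIM}(G)$ calls $\mathrm{Rec}(\emptyset,G)$, where $\mathrm{Rec}(M,H)$ is: if $H$ has no edges, output $M$ and return; otherwise choose a vertex $v$ of maximum degree in $H$; call $\mathrm{Rec}(M,H\setminus\{v\})$ (delete vertex $v$); then let $H'$ be the graph obtained from $H$ by deleting the closed neighbourhood $N_H[v]$; for each edge $e$ of $H$ incident to $v$, call $\mathrm{Rec}(M\cup\{e\},H'\setminus \mathrm{Sect}_e(2))$ (deleting the edges of $\mathrm{Sect}_e(2)$, computed in $H$);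 then return. *)

theory Defs
  imports Main "HOL-Library.Extended_Nat"
begin

typedef 'a graph =
  "{(V, E). finite V \<and> (\<forall>e\<in>E. e \<subseteq> V \<and> card e = 2)} :: ('a set \<times> 'a set set) set"
  by (rule exI[of _ "({}, {})"]) auto

setup_lifting type_definition_graph

lift_definition verts :: "'a graph \<Rightarrow> 'a set" is fst .

lift_definition edges :: "'a graph \<Rightarrow> 'a set set" is snd .

lift_definition delete_verts :: "'a graph \<Rightarrow> 'a set \<Rightarrow> 'a graph"
  is "\<lambda>(V, E) S. (V - S, {e \<in> E. e \<inter> S = {}})"
  by auto

lift_definition delete_edges :: "'a graph \<Rightarrow> 'a set set \<Rightarrow> 'a graph"
  is "\<lambda>(V, E) F. (V, E - F)"
  by auto

lemma finite_verts [simp]: "finite (verts H)"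
  by transfer auto

lemma edgesD:
  assumes "e \<in> edges H"
  shows "e \<subseteq> verts H" "card e = 2"
  using assms by (transfer, auto)+

lemma verts_delete_verts [simp]: "verts (delete_verts H S) = verts H - S"
  by transfer auto

lemma edges_delete_verts [simp]: "edges (delete_verts H S) = {e \<in> edges H. e \<inter> S = {}}"
  by transfer auto

lemma verts_delete_edges [simp]: "verts (delete_edges H F) = verts H"
  by transfer auto

lemma edges_delete_edges [simp]: "edges (delete_edges H F) = edges H - F"
  by transfer auto

definition adj :: "'a graph \<Rightarrow> 'a \<Rightarrow> 'a \<Rightarrow> bool" where
  "adj H x y \<longleftrightarrow> {x, y} \<in> edges H"

definition incident_edges :: "'a graph \<Rightarrow> 'a \<Rightarrow> 'a set set" where
  "incident_edges H v = {e \<in> edges H. v \<in> e}"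

definition degree :: "'a graph \<Rightarrow> 'a \<Rightarrow> nat" where
  "degree H v = card (incident_edges H v)"

definition max_degree_vertex :: "'a graph \<Rightarrow> 'a \<Rightarrow> bool" where
  "max_degree_vertex H v \<longleftrightarrow> v \<in> verts H \<and> (\<forall>u\<in>verts H. degree H u \<le> degree H v)"

definition closed_nbhd :: "'a graph \<Rightarrow> 'a \<Rightarrow> 'a set" where
  "closed_nbhd H v = insert v {u. adj H v u}"

definition C4_free :: "'a graph \<Rightarrow> bool" where
  "C4_free G \<longleftrightarrow>
     \<not> (\<exists>a b c d. distinct [a, b, c, d] \<and> adj G a b \<and> adj G b c \<and> adj G c d \<and> adj G d a)"

definition induced_matching :: "'a graph \<Rightarrow> 'a set set \<Rightarrow> bool" where
  "induced_matching G M \<longleftrightarrow>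
     M \<subseteq> edges G \<and>
     (\<forall>e\<in>M. \<forall>e'\<in>M. e \<noteq> e' \<longrightarrow> e \<inter> e' = {} \<and> \<not> (\<exists>x\<in>e. \<exists>y\<in>e'. adj G x y))"

definition walk :: "'a graph \<Rightarrow> 'a \<Rightarrow> 'a list \<Rightarrow> 'a \<Rightarrow> bool" where
  "walk H u p v \<longleftrightarrow>
     p \<noteq> [] \<and> hd p = u \<and> last p = v \<and> set p \<subseteq> verts H \<and> successively (adj H) p"

text \<open>Distances take the value \<open>\<infinity>\<close> when there is no connecting walk.\<close>

definition vdist :: "'a graph \<Rightarrow> 'a \<Rightarrow> 'a \<Rightarrow> enat" where
  "vdist H u v = (INF p\<in>{p. walk H u p v}. enat (length p - 1))"

definition vertex_edge_dist :: "'a graph \<Rightarrow> 'a \<Rightarrow> 'a set \<Rightarrow> enat" where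
  "vertex_edge_dist H v f = (INF y\<in>f. vdist H v y)"

definition edge_dist :: "'a graph \<Rightarrow> 'a set \<Rightarrow> 'a set \<Rightarrow> enat" where
  "edge_dist H e f = (INF x\<in>e. INF y\<in>f. vdist H x y)"

definition D2 :: "'a graph \<Rightarrow> 'a \<Rightarrow> nat \<Rightarrow> nat \<Rightarrow> 'a set set" where
  "D2 H v k l = {{x, y} | x y. {x, y} \<in> edges H \<and> vdist H x v = enat k \<and> vdist H y v = enat l}"

definition D :: "'a graph \<Rightarrow> 'a \<Rightarrow> nat \<Rightarrow> 'a set set" where
  "D H v k = D2 H v k k \<union> D2 H v k (k + 1)"

definition Sect2 :: "'a graph \<Rightarrow> 'a \<Rightarrow> 'a set \<Rightarrow> 'a set set" where
  "Sect2 H v e = {f \<in> D H v 2. vertex_edge_dist H v f = 2 \<and> edge_dist H e f = 1}"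

text \<open>
  The pivot \<open>v\<close> and the order \<open>es\<close> in which the edges at \<open>v\<close> are processed are not determined by
  the algorithm. \<open>Rec M H\<close> is the set of all output sequences that the call can produce,
  over all such choices made independently in every recursive call.
\<close>

context
  notes conj_cong [fundef_cong]
begin

function Rec :: "'a set set \<Rightarrow> 'a graph \<Rightarrow> 'a set set list set" where
  "Rec M H =
     (if edges H = {} then {[M]}
      else {out @ concat outs | v out es outs.
        max_degree_vertex H v \<and>
        out \<in> Rec M (delete_verts H {v}) \<and>
        distinct es \<and> set es = incident_edges H v \<and>
        list_all2
          (\<lambda>e out'. out' \<in> Rec (insert e M)
             (delete_edges (delete_verts H (closed_nbhd H v)) (Sect2 H v e)))
          es outs})"
  by pat_completeness auto
termination
proof (relation "measure (\<lambda>(M, H). card (verts H))", goal_cases)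
  case 1
  show ?case by simp
next
  case (2 M H)
  then show ?case
    by (auto simp: max_degree_vertex_def simp del: card_Diff_insert intro!: card_Diff1_less)
next
  case (3 M H)
  then show ?case
    by (auto simp: max_degree_vertex_def closed_nbhd_def intro!: psubset_card_mono)
qed

end

declare Rec.simps [simp del]

definition EnumIM :: "'a graph \<Rightarrow> 'a set set list set" where
  "EnumIM G = Rec {} G"

end

(* Every edge outside N[v] that meets a neighbour of u lies in Sect_e(2), where e = {u,v}.  Hence
   the graph passed to the recursive call for e has exactly those edges of H that avoid
   N[u] and N[v], and its induced matchings are the sets N such that insert e N is an induced
   matching of H and e is not in N.  An induced matching contains at most one edge at v, so the
   recursive calls split the induced matchings of H into disjoint classes. *)
theory Submission
  imports Defs
begin

section \<open>Edges, walks and distances\<close>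

lemma adj_sym: "adj H x y \<Longrightarrow> adj H y x"
  by (simp add: adj_def insert_commute)

lemma adj_verts: "adj H x y \<Longrightarrow> x \<in> verts H \<and> y \<in> verts H \<and> x \<noteq> y"
  using edgesD[of "{x, y}" H] by (auto simp: adj_def card_insert_if split: if_splits)

lemma edge_at:
  assumes "e \<in> edges H" "x \<in> e"
  obtains y where "e = {x, y}" "adj H x y"
proof -
  obtain a b where "e = {a, b}"
    using edgesD(2)[OF assms(1)] by (auto simp: card_2_iff)
  with assms have "e = {x, a} \<or> e = {x, b}" by auto
  with assms(1) that show thesis by (auto simp: adj_def)
qed

lemma finite_edges: "finite (edges H)"
  by (rule finite_subset[of _ "Pow (verts H)"]) (auto dest: edgesD(1))

lemma walk_rev: "walk H u p v \<Longrightarrow> walk H v (rev p) u"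
  using adj_sym[of H]
  by (auto simp: walk_def hd_rev last_rev elim!: successively_mono)

text \<open>Reversing a walk keeps its length, so each of the two infima bounds the other. This
  reconciles \<open>D2\<close>, which measures distances to the pivot, with the bounds measured from
  the pivot.\<close>

lemma vdist_commute: "vdist H u v = vdist H v u"
proof -
  have "vdist H v u \<le> vdist H u v" for u v
    unfolding vdist_def
  proof (rule INF_greatest)
    fix p assume "p \<in> {p. walk H u p v}"
    then show "(INF p\<in>{p. walk H v p u}. enat (length p - 1)) \<le> enat (length p - 1)"
      by (intro INF_lower2[of "rev p"]) (auto intro: walk_rev)
  qed
  then show ?thesis by (simp add: antisym)
qed

lemma vdist_le_walk: "walk H u p v \<Longrightarrow> vdist H u v \<le> enat (length p - 1)"
  unfolding vdist_def by (rule INF_lower) simp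

lemma vdist_less_walk:
  assumes "vdist H u v < enat n"
  obtains p where "walk H u p v" "length p - 1 < n"
  using assms by (auto simp: vdist_def INF_less_iff)

lemma vdist_less_1: "vdist H x y < 1 \<Longrightarrow> x = y"
  unfolding one_enat_def
  by (erule vdist_less_walk) (auto simp: walk_def neq_Nil_conv)

lemma vdist_less_2:
  assumes "vdist H x y < 2"
  shows "x = y \<or> adj H x y"
proof -
  from assms obtain p where p: "walk H x p y" "length p - 1 < 2"
    unfolding numeral_eq_enat by (rule vdist_less_walk)
  then have "length p = 1 \<or> length p = 2" by (auto simp: walk_def neq_Nil_conv less_2_cases_iff)
  with p(1) show ?thesis
    by (auto simp: walk_def length_Suc_conv numeral_2_eq_2)
qed

lemma vdist_adj: "adj H x y \<Longrightarrow> vdist H x y \<le> 1"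
  using vdist_le_walk[of H x "[x, y]" y] adj_verts[of H x y]
  by (simp add: walk_def one_enat_def)

text \<open>The listed vertices form a walk, not necessarily a path: \<open>z\<close> may equal
  \<open>x\<close>. Hence this is only an upper bound.\<close>

lemma vdist_path3: "adj H x y \<Longrightarrow> adj H y z \<Longrightarrow> vdist H x z \<le> 2"
  using vdist_le_walk[of H x "[x, y, z]" z] adj_verts[of H x y] adj_verts[of H y z]
  by (simp add: walk_def numeral_eq_enat eval_nat_numeral)

lemma vdist_path4: "adj H x y \<Longrightarrow> adj H y z \<Longrightarrow> adj H z w \<Longrightarrow> vdist H x w \<le> 3"
  using vdist_le_walk[of H x "[x, y, z, w]" w]
    adj_verts[of H x y] adj_verts[of H y z] adj_verts[of H z w]
  by (simp add: walk_def numeral_eq_enat eval_nat_numeral)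

section \<open>Sections of edges around the pivot\<close>

lemma vdist_ge_2:
  assumes "y \<notin> closed_nbhd H v"
  shows "2 \<le> vdist H v y"
proof (rule leI, rule notI)
  assume "vdist H v y < 2"
  with assms show False by (auto simp: closed_nbhd_def dest: vdist_less_2)
qed

lemma enat_between_2_3: "2 \<le> (d :: enat) \<Longrightarrow> d \<le> 3 \<Longrightarrow> d = 2 \<or> d = 3"
  by (cases d) (auto simp: numeral_eq_enat)

text \<open>If \<open>f\<close> is at distance one from \<open>{v, u}\<close>, the nearby endpoint
  of \<open>{v, u}\<close> must be \<open>u\<close>, because \<open>f\<close> avoids the closed
  neighbourhood of \<open>v\<close>. Conversely, if an endpoint \<open>y\<close> of
  \<open>f = {y, z}\<close> is adjacent to \<open>u\<close>, the walks \<open>v, u, y\<close> and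
  \<open>v, u, y, z\<close> place \<open>y\<close> at distance exactly 2 and \<open>z\<close> at
  distance 2 or 3, which is what \<open>D H v 2\<close> asks for.\<close>

lemma Sect2_iff:
  assumes uv: "adj H v u" and f: "f \<in> edges H" "f \<inter> closed_nbhd H v = {}"
  shows "f \<in> Sect2 H v {v, u} \<longleftrightarrow> f \<inter> closed_nbhd H u \<noteq> {}"
proof
  assume "f \<in> Sect2 H v {v, u}"
  \<comment> \<open>A strict bound on an infimum yields a pair of endpoints satisfying it, so
    distance one is used in the form \<open>< 2\<close>.\<close>
  then have "edge_dist H {v, u} f < 2"
    by (simp add: Sect2_def one_enat_def numeral_eq_enat)
  then obtain x y where "x \<in> {v, u}" "y \<in> f" "vdist H x y < 2"
    unfolding edge_dist_def INF_less_iff by blast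
  then show "f \<inter> closed_nbhd H u \<noteq> {}"
    using f(2) vdist_less_2[of H x y] by (auto simp: closed_nbhd_def)
next
  assume "f \<inter> closed_nbhd H u \<noteq> {}"
  then obtain y where y: "y \<in> f" "y \<in> closed_nbhd H u" by blast
  have "u \<in> closed_nbhd H v" using uv by (simp add: closed_nbhd_def)
  \<comment> \<open>The case \<open>y = u\<close> is excluded since \<open>u\<close> is a neighbour
    of \<open>v\<close>, and \<open>f\<close> contains no such vertex.\<close>
  then have uy: "adj H u y" using y f(2) by (auto simp: closed_nbhd_def)
  obtain z where z: "f = {y, z}" "adj H y z" using edge_at[OF f(1) y(1)] .
  have ge: "2 \<le> vdist H v w" if "w \<in> f" for w
    using that f(2) by (intro vdist_ge_2) blast
  have dy: "vdist H v y = 2"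
    using vdist_path3[OF uv uy] ge[OF y(1)] by (rule order.antisym)
  have dz: "vdist H v z = 2 \<or> vdist H v z = 3"
    using ge[of z] z vdist_path4[OF uv uy z(2)] by (intro enat_between_2_3) auto
  have "f \<in> D2 H v 2 2 \<or> f \<in> D2 H v 2 3"
    using dy dz z(1) f(1) unfolding D2_def vdist_commute[of H _ v] numeral_eq_enat by blast
  then have "f \<in> D H v 2" by (simp add: D_def)
  moreover have "vertex_edge_dist H v f = 2"
    unfolding vertex_edge_dist_def
    using ge y(1) dy by (intro antisym INF_greatest) (auto intro: INF_lower2)
  moreover have "edge_dist H {v, u} f = 1"
  proof (rule antisym)
    show "edge_dist H {v, u} f \<le> 1"
      unfolding edge_dist_def using vdist_adj[OF uy] y(1)
      by (intro INF_lower2[of u] INF_lower2[of y]) auto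
    have "1 \<le> vdist H x w" if "x \<in> {v, u}" "w \<in> f" for x w
    proof -
      have "x \<noteq> w" using that f(2) uv by (auto simp: closed_nbhd_def)
      then show ?thesis using vdist_less_1[of H x w] leI by blast
    qed
    then show "1 \<le> edge_dist H {v, u} f"
      unfolding edge_dist_def by (intro INF_greatest) auto
  qed
  ultimately show "f \<in> Sect2 H v {v, u}" by (simp add: Sect2_def)
qed

section \<open>Induced matchings of the graphs passed to recursive calls\<close>

lemma edges_branch:
  assumes "adj H v u"
  shows "edges (delete_edges (delete_verts H (closed_nbhd H v)) (Sect2 H v {v, u})) =
    {f \<in> edges H. f \<inter> (closed_nbhd H v \<union> closed_nbhd H u) = {}}"
  using Sect2_iff[OF assms] by auto

text \<open>If two edges avoid \<open>S\<close>, so does every pair joining their endpoints;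
  \<open>K\<close> and \<open>H\<close> therefore agree on all adjacencies that the definition
  inspects. Stating the hypothesis through edge sets covers both the deletion of the pivot and the
  branch graphs.\<close>

lemma induced_matching_subgraph:
  assumes "edges K = {f \<in> edges H. f \<inter> S = {}}"
  shows "induced_matching K N \<longleftrightarrow> induced_matching H N \<and> (\<forall>f\<in>N. f \<inter> S = {})"
proof (cases "\<forall>f\<in>N. f \<inter> S = {}")
  case True
  then have "\<forall>e\<in>N. \<forall>e'\<in>N. (\<exists>x\<in>e. \<exists>y\<in>e'. adj K x y) \<longleftrightarrow> (\<exists>x\<in>e. \<exists>y\<in>e'. adj H x y)"
    by (fastforce simp: adj_def assms)
  moreover have "N \<subseteq> edges K \<longleftrightarrow> N \<subseteq> edges H"
    using True assms by auto
  ultimately show ?thesis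
    using True by (simp add: induced_matching_def)
next
  case False
  then show ?thesis
    using assms by (auto simp: induced_matching_def)
qed

text \<open>Avoiding both closed neighbourhoods is exactly the pairwise condition between
  \<open>f\<close> and \<open>{v, u}\<close>. The edge \<open>{v, u}\<close> itself violates it,
  which matches the conjunct \<open>{v, u} \<notin> N\<close> on the left.\<close>

lemma induced_matching_insert:
  assumes "adj H v u"
  shows "induced_matching H (insert {v, u} N) \<and> {v, u} \<notin> N \<longleftrightarrow>
    induced_matching H N \<and> (\<forall>f\<in>N. f \<inter> (closed_nbhd H v \<union> closed_nbhd H u) = {})"
    (is "?L \<longleftrightarrow> ?R")
proof -
  have far: "f \<inter> (closed_nbhd H v \<union> closed_nbhd H u) = {} \<longleftrightarrow>
      {v, u} \<inter> f = {} \<and> \<not> (\<exists>x\<in>{v, u}. \<exists>y\<in>f. adj H x y)" for f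
    by (auto simp: closed_nbhd_def)
  \<comment> \<open>Symmetry handles the pairs in which \<open>{v, u}\<close> comes second.\<close>
  have swap: "(\<exists>x\<in>f. \<exists>y\<in>g. adj H x y) \<longleftrightarrow> (\<exists>x\<in>g. \<exists>y\<in>f. adj H x y)" for f g
    using adj_sym[of H] by blast
  have edge: "{v, u} \<in> edges H" using assms by (simp add: adj_def)
  show ?thesis
  proof
    assume ?L
    then show ?R unfolding far induced_matching_def by auto
  next
    assume R: ?R
    then have "{v, u} \<notin> N" by (auto simp: closed_nbhd_def)
    moreover have "e \<inter> e' = {} \<and> \<not> (\<exists>x\<in>e. \<exists>y\<in>e'. adj H x y)"
      if e: "e \<in> insert {v, u} N" and e': "e' \<in> insert {v, u} N" and "e \<noteq> e'" for e e'
    proof -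
      consider "e = {v, u}" "e' \<in> N" | "e' = {v, u}" "e \<in> N" | "e \<in> N" "e' \<in> N"
        using e e' \<open>e \<noteq> e'\<close> by blast
      then show ?thesis
      proof cases
        case 1
        then show ?thesis using R unfolding far by simp
      next
        case 2
        then show ?thesis using R unfolding far swap[of e] by (simp add: Int_commute)
      next
        case 3
        then show ?thesis using R \<open>e \<noteq> e'\<close> by (simp add: induced_matching_def)
      qed
    qed
    ultimately show ?L using R edge by (simp add: induced_matching_def)
  qed
qed

lemma induced_matching_branch:
  assumes "e \<in> incident_edges H v"
  shows "induced_matching (delete_edges (delete_verts H (closed_nbhd H v)) (Sect2 H v e)) N \<longleftrightarrow>
    induced_matching H (insert e N) \<and> e \<notin> N"
proof -
  obtain u where u: "e = {v, u}" "adj H v u"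
    using assms edge_at[of e H v] by (auto simp: incident_edges_def)
  show ?thesis
    unfolding u(1) induced_matching_subgraph[OF edges_branch[OF u(2)]]
      induced_matching_insert[OF u(2)] ..
qed

lemma induced_matching_unique_edge:
  "\<lbrakk>induced_matching H N; e \<in> N; e' \<in> N; v \<in> e; v \<in> e'\<rbrakk> \<Longrightarrow> e = e'"
  by (auto simp: induced_matching_def)

text \<open>The cases are whether \<open>N\<close> has an edge at \<open>v\<close>. Without one,
  \<open>N\<close> lives in the graph with \<open>v\<close> deleted; with an edge \<open>e\<close>
  at \<open>v\<close>, removing \<open>e\<close> leaves an induced matching of the branch graph of
  \<open>e\<close>.\<close>

lemma induced_matchings_split:
  "{N. induced_matching H N} = {N. induced_matching (delete_verts H {v}) N} \<union>
    (\<Union>e\<in>incident_edges H v. insert e `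
      {N. induced_matching (delete_edges (delete_verts H (closed_nbhd H v)) (Sect2 H v e)) N})"
    (is "?A = ?B \<union> ?C")
proof -
  have B: "?B = {N. induced_matching H N \<and> (\<forall>f\<in>N. v \<notin> f)}"
    using induced_matching_subgraph[of "delete_verts H {v}" H "{v}"] by auto
  have C: "N \<in> ?C \<longleftrightarrow> induced_matching H N \<and> (\<exists>e\<in>N. v \<in> e)" for N
  proof
    assume "N \<in> ?C"
    then obtain e N' where e: "e \<in> incident_edges H v" and "N = insert e N'"
      and "induced_matching (delete_edges (delete_verts H (closed_nbhd H v)) (Sect2 H v e)) N'"
      by blast
    then show "induced_matching H N \<and> (\<exists>e\<in>N. v \<in> e)"
      using induced_matching_branch[OF e] by (simp add: incident_edges_def)
  next
    assume N: "induced_matching H N \<and> (\<exists>e\<in>N. v \<in> e)"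
    then obtain e where e: "e \<in> N" "v \<in> e" by blast
    then have inc: "e \<in> incident_edges H v"
      using N by (auto simp: incident_edges_def induced_matching_def)
    then have "N \<in> insert e ` {N. induced_matching
        (delete_edges (delete_verts H (closed_nbhd H v)) (Sect2 H v e)) N}"
      using N e(1) induced_matching_branch[OF inc, of "N - {e}"]
      by (intro image_eqI[of _ _ "N - {e}"]) (simp_all add: insert_absorb)
    with inc show "N \<in> ?C" by blast
  qed
  show ?thesis
    by (rule set_eqI, unfold Un_iff C B mem_Collect_eq) blast
qed

section \<open>Contents and distinctness of the output sequences\<close>

lemma distinct_concat_blocks:
  assumes "list_all2 (\<lambda>x ys. distinct ys \<and> set ys = F x) xs yss" "distinct xs"
    and "\<And>x x'. x \<in> set xs \<Longrightarrow> x' \<in> set xs \<Longrightarrow> x \<noteq> x' \<Longrightarrow> F x \<inter> F x' = {}"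
  shows "distinct (concat yss) \<and> set (concat yss) = (\<Union>x\<in>set xs. F x)"
  using assms
proof (induction rule: list_all2_induct)
  case Nil
  then show ?case by simp
next
  case (Cons x xs ys yss)
  then have IH: "distinct (concat yss)" "set (concat yss) = (\<Union>x\<in>set xs. F x)" by auto
  have "F x \<inter> F x' = {}" if "x' \<in> set xs" for x'
    using Cons.prems that by (intro Cons.prems(2)) auto
  then have "F x \<inter> (\<Union>x\<in>set xs. F x) = {}" by blast
  then show ?case using IH Cons.hyps(1) by simp
qed

lemma count_list_distinct: "distinct xs \<Longrightarrow> x \<in> set xs \<Longrightarrow> count_list xs x = 1"
  by (induction xs) auto

text \<open>Induction on the number of vertices. The invariant that \<open>M\<close> contains no
  edge of \<open>H\<close> makes \<open>N\<close> recoverable from \<open>M \<union> N\<close>, so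
  different induced matchings of \<open>H\<close> give different outputs and disjointness of the
  branches carries over to the outputs.\<close>

lemma Rec_correct:
  assumes "out \<in> Rec M H" "M \<inter> edges H = {}"
  shows "distinct out \<and> set out = (\<union>) M ` {N. induced_matching H N}"
  using assms
proof (induction "card (verts H)" arbitrary: out M H rule: less_induct)
  case less
  show ?case
  proof (cases "edges H = {}")
    case True
    then have "{N. induced_matching H N} = {{}}" by (auto simp: induced_matching_def)
    moreover have "out = [M]" using less.prems(1) True by (simp add: Rec.simps[of M H])
    ultimately show ?thesis by simp
  next
    case False
    let ?K = "\<lambda>v e. delete_edges (delete_verts H (closed_nbhd H v)) (Sect2 H v e)"
    obtain v out0 es outs where out: "out = out0 @ concat outs"
      and v: "max_degree_vertex H v"
      and out0: "out0 \<in> Rec M (delete_verts H {v})"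
      and es: "distinct es" "set es = incident_edges H v"
      and outs: "list_all2 (\<lambda>e out'. out' \<in> Rec (insert e M) (?K v e)) es outs"
      using less.prems(1) False by (auto simp: Rec.simps[of M H])
    have vV: "v \<in> verts H" using v by (simp add: max_degree_vertex_def)
    have cards: "card (verts (delete_verts H {v})) < card (verts H)"
      "card (verts (?K v e)) < card (verts H)" for e
      using vV by (auto simp: closed_nbhd_def simp del: card_Diff_insert intro!: psubset_card_mono)
    \<comment> \<open>\<open>A\<close> collects the expected outputs of the call that deletes
      \<open>v\<close>, and \<open>F e\<close> those of the call for \<open>e\<close>.\<close>
    define A where "A = (\<union>) M ` {N. induced_matching (delete_verts H {v}) N}"
    define F where "F e = (\<union>) (insert e M) ` {N. induced_matching (?K v e) N}" for e
    have A: "distinct out0 \<and> set out0 = A"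
      unfolding A_def using less.prems(2) by (intro less.hyps cards out0) auto
    have "list_all2 (\<lambda>e out'. distinct out' \<and> set out' = F e) es outs"
      using outs
    proof (rule list.rel_mono_strong)
      fix e out' assume "e \<in> set es" and r: "out' \<in> Rec (insert e M) (?K v e)"
      \<comment> \<open>The invariant survives: edges of the branch graph are edges of
        \<open>H\<close>, and \<open>e\<close> is not among them because it contains
        \<open>v\<close>.\<close>
      then have "insert e M \<inter> edges (?K v e) = {}"
        using less.prems(2) es(2) by (auto simp: incident_edges_def closed_nbhd_def)
      then show "distinct out' \<and> set out' = F e"
        unfolding F_def by (intro less.hyps cards r)
    qed
    moreover have F_split: "\<exists>N. X = M \<union> N \<and> e \<in> N \<and> v \<in> e \<and> induced_matching H N"
      if e: "e \<in> incident_edges H v" and X: "X \<in> F e" for e X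
    proof -
      obtain N where "X = insert e M \<union> N" "induced_matching (?K v e) N"
        using X unfolding F_def by blast
      then have "X = M \<union> insert e N" "induced_matching H (insert e N)"
        using induced_matching_branch[OF e] by auto
      moreover have "v \<in> e" using e by (simp add: incident_edges_def)
      ultimately show ?thesis by blast
    qed
    \<comment> \<open>Intersecting with \<open>edges H\<close> cancels \<open>M\<close>.\<close>
    have union_eqD: "N = N'" if "M \<union> N = M \<union> N'" "induced_matching H N" "induced_matching H N'"
      for N N'
    proof -
      have "N = (M \<union> N) \<inter> edges H" "N' = (M \<union> N') \<inter> edges H"
        using that(2,3) less.prems(2) by (auto simp: induced_matching_def)
      then show ?thesis using that(1) by simp
    qed
    have "F e \<inter> F e' = {}" if e: "e \<in> set es" "e' \<in> set es" "e \<noteq> e'" for e e'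
    proof (rule ccontr)
      assume "F e \<inter> F e' \<noteq> {}"
      then obtain X where "X \<in> F e" "X \<in> F e'" by blast
      then obtain N N' where "X = M \<union> N" "e \<in> N" "v \<in> e" "induced_matching H N"
        and "X = M \<union> N'" "e' \<in> N'" "v \<in> e'" "induced_matching H N'"
        using F_split e(1,2) es(2) by metis
      \<comment> \<open>A common output would force \<open>e\<close> and \<open>e'\<close> into one
        induced matching although both contain \<open>v\<close>.\<close>
      then show False
        using union_eqD[of N N'] induced_matching_unique_edge[of H N e e' v] e(3) by simp
    qed
    ultimately have C: "distinct (concat outs) \<and> set (concat outs) = (\<Union>e\<in>set es. F e)"
      using es(1) by (intro distinct_concat_blocks) auto
    have "A \<inter> F e = {}" if "e \<in> set es" for e
    proof (rule ccontr)
      assume "A \<inter> F e \<noteq> {}"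
      then obtain X where X: "X \<in> A" "X \<in> F e" by blast
      obtain N where "X = M \<union> N" "\<forall>f\<in>N. v \<notin> f" "induced_matching H N"
        using X(1) induced_matching_subgraph[of "delete_verts H {v}" H "{v}"]
        by (auto simp: A_def)
      moreover obtain N' where "X = M \<union> N'" "e \<in> N'" "v \<in> e" "induced_matching H N'"
        using F_split[OF _ X(2)] \<open>e \<in> set es\<close> es(2) by blast
      \<comment> \<open>Equality of \<open>N\<close> and \<open>N'\<close> is impossible:
        \<open>N'\<close> has the edge \<open>e\<close> at \<open>v\<close>, while \<open>N\<close>
        has no edge at \<open>v\<close>.\<close>
      ultimately show False using union_eqD[of N N'] by auto
    qed
    then have "distinct out" using A C by (auto simp: out)
    moreover have "set out = A \<union> (\<Union>e\<in>incident_edges H v. F e)" using A C es(2) by (simp add: out)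
    \<comment> \<open>The image is taken over the split, using that
      \<open>insert e M \<union> N\<close> equals \<open>M \<union> insert e N\<close>.\<close>
    moreover have "\<dots> = (\<union>) M ` {N. induced_matching H N}"
      unfolding induced_matchings_split[of H v] A_def F_def
      by (simp add: image_Un image_UN image_image)
    ultimately show ?thesis by simp
  qed
qed

section \<open>Existence of an output sequence\<close>

lemma ex_max_degree_vertex:
  assumes "edges H \<noteq> {}"
  shows "\<exists>v. max_degree_vertex H v"
proof -
  obtain e where e: "e \<in> edges H" using assms by blast
  have "e \<noteq> {}" using edgesD(2)[OF e] by auto
  then have "verts H \<noteq> {}" using edgesD(1)[OF e] by auto
  then have "Max (degree H ` verts H) \<in> degree H ` verts H" by (intro Max_in) auto
  then obtain v where "v \<in> verts H" "degree H v = Max (degree H ` verts H)" by auto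
  then show ?thesis by (auto simp: max_degree_vertex_def)
qed

text \<open>This keeps the claim about all output sequences from being vacuous. A pivot exists
  whenever there is an edge, its finitely many incident edges can be listed, and every recursive
  call has fewer vertices.\<close>

lemma Rec_nonempty: "Rec M H \<noteq> {}"
proof (induction "card (verts H)" arbitrary: M H rule: less_induct)
  case less
  show ?case
  proof (cases "edges H = {}")
    case True
    then show ?thesis by (simp add: Rec.simps[of M H])
  next
    case False
    then obtain v where v: "max_degree_vertex H v" using ex_max_degree_vertex by blast
    let ?K = "\<lambda>e. delete_edges (delete_verts H (closed_nbhd H v)) (Sect2 H v e)"
    have vV: "v \<in> verts H" using v by (simp add: max_degree_vertex_def)
    have "Rec M (delete_verts H {v}) \<noteq> {}"
      using vV by (intro less.hyps) (auto simp del: card_Diff_insert intro!: psubset_card_mono)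
    then obtain out0 where out0: "out0 \<in> Rec M (delete_verts H {v})" by blast
    \<comment> \<open>Since \<open>v\<close> belongs to its own closed neighbourhood, the graph
      shrinks for every \<open>e\<close>; one output per edge can then be chosen by a total function
      \<open>g\<close>.\<close>
    have "Rec (insert e M) (?K e) \<noteq> {}" for e
      using vV by (intro less.hyps) (auto simp: closed_nbhd_def simp del: card_Diff_insert intro!: psubset_card_mono)
    then have "\<forall>e. \<exists>out'. out' \<in> Rec (insert e M) (?K e)" by blast
    then obtain g where g: "g e \<in> Rec (insert e M) (?K e)" for e by metis
    have "finite (incident_edges H v)"
      using finite_edges[of H] by (simp add: incident_edges_def)
    then obtain es where es: "set es = incident_edges H v" "distinct es"
      using finite_distinct_list by blast
    have "list_all2 (\<lambda>e out'. out' \<in> Rec (insert e M) (?K e)) es (map g es)"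
      using g by (simp add: list_all2_conv_all_nth)
    then have "out0 @ concat (map g es) \<in> Rec M H"
      using False v out0 es by (subst Rec.simps) auto
    then show ?thesis by blast
  qed
qed

theorem theorem1:
  fixes G :: "'a graph"
  assumes "C4_free G"
  shows "EnumIM G \<noteq> {} \<and>
    (\<forall>out\<in>EnumIM G.
       (\<forall>M. induced_matching G M \<longrightarrow> M \<in> set out) \<and>
       (\<forall>M\<in>set out. induced_matching G M) \<and>
       (\<forall>M. induced_matching G M \<longrightarrow> count_list out M = 1))"
proof -
  \<comment> \<open>For \<open>M = {}\<close> the invariant is trivial and the union with
    \<open>M\<close> is the identity.\<close>
  have "distinct out \<and> set out = {M. induced_matching G M}" if "out \<in> EnumIM G" for out
    using Rec_correct[of out "{}" G] that by (simp add: EnumIM_def)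
  moreover have "EnumIM G \<noteq> {}" by (simp add: EnumIM_def Rec_nonempty)
  ultimately show ?thesis
    by (simp add: count_list_distinct)
qed

end
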